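(* Let $r\ge 1$ be an integer and suppose that $A\subseteq\mathbb{F}_2^r$ is round. If $|A|>\frac13\,2^r+2$, then there are a sum-free set $S\subseteq\mathbb{F}_2^r$ and an element $g\in\mathbb{F}_2^r$ such that $A=g+(S\cup\{0\})$.
   Context: $\mathbb{F}_2^r$ denotes the elementary abelian $2$-group of rank $r$. For $X\subseteq\mathbb{F}_2^r$, $2X:=\{x_1+x_2\colon x_1,x_2\in X\}$ (with $x_1=x_2$ allowed), and $g+X:=\{g+x\colon x\in X\}$. A set $A\subseteq\mathbb{F}_2^r$ is round if $2B\ne 2A$ for every proper subset $B\subsetneq A$. A set $S$ is sum-free if $S\cap 2S=\varnothing$. *)

theory Defs
  imports
    "HOL-Library.Z2"
    "HOL-Library.Set_Algebras"
    "HOL-Analysis.Finite_Cartesian_Product"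
begin

text \<open>
  The group \<open>F\<^sub>2\<^sup>r\<close> is rendered as \<^typ>\<open>bit ^ 'n\<close>, with \<open>r = CARD('n)\<close>. The operations
  \<open>X + X\<close> and \<open>g +o X\<close> on sets are the Minkowski sum and the translate.
\<close>

definition round_set :: "'a::plus set \<Rightarrow> bool"
  where "round_set A \<longleftrightarrow> (\<forall>B. B \<subset> A \<longrightarrow> B + B \<noteq> A + A)"

definition sum_free :: "'a::plus set \<Rightarrow> bool"
  where "sum_free S \<longleftrightarrow> S \<inter> (S + S) = {}"

end

theory Submission
  imports Defs
begin

text \<open>
  Join two distinct points of \<open>A\<close> by an edge if their sum has no other representation in
  \<open>A + A\<close>; roundness means that no vertex is isolated, and the conclusion says that some vertex
  \<open>g\<close> is joined to all others. As a graph without isolated vertices and without two disjoint edges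
  is a star or a triangle, it suffices to exclude disjoint edges.

  Let \<open>D\<close> be the set of sums over all edges, and let \<open>N\<close> be the order of the group.
  For \<open>d \<in> D\<close> the sets \<open>A\<close> and \<open>d + A\<close> share just two points. If \<open>3|A| > N + 6\<close>, then
  \<open>A\<close>, \<open>d + A\<close>, \<open>d' + A\<close> cannot be nearly disjoint, so \<open>d + d'\<close> has many
  representations and \<open>D\<close> is sum-free. For an edge \<open>ab\<close> with sum \<open>d\<close>, the complement \<open>V\<close> of
  \<open>(a + A) \<union> (b + A)\<close> has size \<open>N - 2|A| + 2\<close>, is invariant under translation by \<open>d\<close>, and contains
  the set \<open>D'\<close> of the sums over all edges missing \<open>a\<close> and \<open>b\<close>. As \<open>D'\<close> and \<open>d + D'\<close> are
  disjoint, \<open>2|D'| \<le> |V|\<close>. Choosing \<open>ab\<close> to be the one of two disjoint edges with the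
  smaller degree sum, and counting degrees, one gets \<open>3|A| \<le> N + 6\<close>.
\<close>

section \<open>Graphs of unique sums and graphs with pairwise meeting edges\<close>

definition unique_sum :: "'a::plus set \<Rightarrow> 'a \<Rightarrow> 'a \<Rightarrow> bool"
  where "unique_sum A a b \<longleftrightarrow> a \<in> A \<and> b \<in> A \<and> a \<noteq> b \<and>
    (\<forall>x\<in>A. \<forall>y\<in>A. x + y = a + b \<longrightarrow> {x, y} = {a, b})"

definition unique_sums :: "'a::plus set \<Rightarrow> 'a set"
  where "unique_sums A = {a + b | a b. unique_sum A a b}"

lemma unique_sumD:
  assumes "unique_sum A a b"
  shows "a \<in> A" "b \<in> A" "a \<noteq> b"
    "\<And>x y. x \<in> A \<Longrightarrow> y \<in> A \<Longrightarrow> x + y = a + b \<Longrightarrow> x = a \<and> y = b \<or> x = b \<and> y = a"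
  using assms by (auto simp: unique_sum_def doubleton_eq_iff)

lemma unique_sum_commute:
  fixes A :: "'a::ab_semigroup_add set"
  shows "unique_sum A a b \<Longrightarrow> unique_sum A b a"
  unfolding unique_sum_def by (metis add.commute insert_commute)

text \<open>Fix an edge \<open>a b\<close>. If \<open>a\<close> misses a vertex \<open>x\<close>,
  then \<open>x\<close> can only be joined to \<open>b\<close>. Then \<open>b\<close> dominates: a
  vertex \<open>z\<close> not joined to \<open>b\<close> would be joined to \<open>a\<close>, and
  \<open>z a\<close>, \<open>x b\<close> would be disjoint.\<close>

lemma ex_dominating_vertex:
  assumes sym: "\<And>x y. E x y \<Longrightarrow> E y x"
    and field: "\<And>x y. E x y \<Longrightarrow> x \<in> A \<and> x \<noteq> y"
    and no_isolated: "\<And>x. x \<in> A \<Longrightarrow> \<exists>y. E x y"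
    and meet: "\<And>a b c d. E a b \<Longrightarrow> E c d \<Longrightarrow> {a, b} \<inter> {c, d} \<noteq> {}"
    and "A \<noteq> {}"
  shows "\<exists>g\<in>A. \<forall>x\<in>A - {g}. E g x"
proof -
  obtain a b where ab: "E a b"
    using no_isolated \<open>A \<noteq> {}\<close> by blast
  show ?thesis
  proof (cases "\<forall>x\<in>A - {a}. E a x")
    case True
    then show ?thesis
      using field[OF ab] by blast
  next
    case False
    then obtain x where x: "x \<in> A" "x \<noteq> a" "\<not> E a x"
      by blast
    then obtain y where "E x y"
      using no_isolated by blast
    with meet[OF ab] x ab sym have bx: "E x b"
      by blast
    have "E b z" if z: "z \<in> A" "z \<noteq> b" for z
    proof (rule ccontr)
      assume nz: "\<not> E b z"
      obtain w where "E z w"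
        using no_isolated z by blast
      with meet[OF ab] z nz sym ab have "E z a"
        by blast
      with meet[OF bx] z x nz sym bx field[OF ab] show False
        by blast
    qed
    then show ?thesis
      using field[OF sym[OF ab]] by blast
  qed
qed

section \<open>Translates and edge sums in a finite group of exponent two\<close>

locale exponent_two =
  fixes A :: "'a::{finite, ab_group_add} set"
  assumes add_self [simp]: "(x::'a) + x = 0"
begin

lemma add_self_left [simp]: "(x::'a) + (x + y) = y"
  by (simp flip: add.assoc)

lemma add_eq_iff: "(x::'a) + y = z \<longleftrightarrow> x = y + z"
  by (metis add.commute add_self_left)

lemma card_translate: "card ((+) (d::'a) ` B) = card B"
  by (simp add: card_image)

lemma Int_translate_unique_sum:
  assumes "unique_sum A a b"
  shows "A \<inter> (+) (a + b) ` A = {a, b}"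
proof
  show "A \<inter> (+) (a + b) ` A \<subseteq> {a, b}"
  proof
    fix z
    assume "z \<in> A \<inter> (+) (a + b) ` A"
    then obtain w where "z \<in> A" "w \<in> A" "z = (a + b) + w"
      by auto
    moreover from this have "z + w = a + b"
      by (simp add: add_eq_iff add.commute)
    ultimately show "z \<in> {a, b}"
      using unique_sumD(4)[OF assms] by blast
  qed
  have "a = (a + b) + b" "b = (a + b) + a"
    by (simp_all add: ac_simps)
  with unique_sumD(1,2)[OF assms] show "{a, b} \<subseteq> A \<inter> (+) (a + b) ` A"
    by blast
qed

lemma card_Int_translate:
  assumes "d \<in> unique_sums A"
  shows "card (A \<inter> (+) d ` A) = 2"
proof -
  obtain a b where ab: "unique_sum A a b" "d = a + b"
    using assms by (auto simp: unique_sums_def)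
  then show ?thesis
    using unique_sumD(3)[OF ab(1)] by (simp add: Int_translate_unique_sum)
qed

text \<open>Otherwise the translates of \<open>A\<close> by \<open>0\<close>, \<open>d\<close>,
  \<open>d'\<close> meet pairwise in two points, so their union has at least
  \<open>3 * card A - 6\<close> points, too many for the group.\<close>

lemma unique_sums_sum_free:
  assumes large: "3 * card A > CARD('a) + 6"
    and d: "d \<in> unique_sums A" and d': "d' \<in> unique_sums A"
  shows "d + d' \<notin> unique_sums A"
proof
  assume dd': "d + d' \<in> unique_sums A"
  define B C where "B = (+) d ` A" and "C = (+) d' ` A"
  have "B \<inter> C = (+) d ` (A \<inter> (+) (d + d') ` A)"
    unfolding B_def C_def by (subst image_Int) (simp_all add: image_image add.assoc)
  then have "card (B \<inter> C) = 2"
    using card_Int_translate[OF dd'] by (simp add: card_translate)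
  moreover have "card (A \<inter> B) = 2" "card (A \<inter> C) = 2"
    using card_Int_translate d d' by (simp_all add: B_def C_def)
  moreover have "card B = card A" "card C = card A"
    by (simp_all add: B_def C_def card_translate)
  moreover have "card A + card B = card (A \<union> B) + card (A \<inter> B)"
    "card (A \<union> B) + card C = card (A \<union> B \<union> C) + card ((A \<union> B) \<inter> C)"
    by (intro card_Un_Int; simp)+
  moreover have "card ((A \<union> B) \<inter> C) \<le> card (A \<inter> C) + card (B \<inter> C)"
    unfolding Int_Un_distrib2 by (rule card_Un_le)
  moreover have "card (A \<union> B \<union> C) \<le> CARD('a)"
    by (simp add: card_mono)
  ultimately show False
    using large by linarith
qed

text \<open>Pairs are ordered, so each edge counts twice; the two disjoint copies \<open>D\<close>
  and \<open>(a + b) + D\<close> in the complement of \<open>U\<close> absorb this factor.\<close>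

lemma card_pairs_missing_edge:
  assumes large: "3 * card A > CARD('a) + 6"
    and ab: "unique_sum A a b"
  shows "card {(x, y). unique_sum A x y \<and> {x, y} \<inter> {a, b} = {}} + 2 * card A \<le> CARD('a) + 2"
proof -
  define P where "P = {(x, y). unique_sum A x y \<and> {x, y} \<inter> {a, b} = {}}"
  define D where "D = (\<lambda>(x, y). x + y) ` P"
  define U where "U = (+) a ` A \<union> (+) b ` A"
  have D_sub: "D \<subseteq> unique_sums A"
    by (auto simp: D_def P_def unique_sums_def)
  have d: "a + b \<in> unique_sums A"
    using ab by (auto simp: unique_sums_def)
  have "card P \<le> 2 * card D"
  proof -
    have "P = (\<Union>s\<in>D. {p \<in> P. fst p + snd p = s})"
      by (auto simp: D_def)
    then have "card P \<le> (\<Sum>s\<in>D. card {p \<in> P. fst p + snd p = s})"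
      using card_UN_le[of D "\<lambda>s. {p \<in> P. fst p + snd p = s}"] by simp
    also have "\<dots> \<le> (\<Sum>s\<in>D. 2)"
    proof (rule sum_mono)
      fix s
      assume "s \<in> D"
      then obtain x y where xy: "unique_sum A x y" "s = x + y"
        by (auto simp: D_def P_def)
      have "{p \<in> P. fst p + snd p = s} \<subseteq> {(x, y), (y, x)}"
      proof
        fix p
        assume "p \<in> {p \<in> P. fst p + snd p = s}"
        then have "unique_sum A (fst p) (snd p)" "fst p + snd p = x + y"
          by (auto simp: P_def xy(2))
        then have "fst p = x \<and> snd p = y \<or> fst p = y \<and> snd p = x"
          by (intro unique_sumD(4)[OF xy(1)] unique_sumD(1,2))
        then show "p \<in> {(x, y), (y, x)}"
          by (auto simp: prod_eq_iff)
      qed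
      moreover have "card {(x, y), (y, x)} = 2"
        using unique_sumD(3)[OF xy(1)] by simp
      ultimately show "card {p \<in> P. fst p + snd p = s} \<le> 2"
        using card_mono[of "{(x, y), (y, x)}"] by simp
    qed
    finally show ?thesis
      by (simp add: mult.commute)
  qed
  also have "2 * card D = card (D \<union> (+) (a + b) ` D)"
  proof -
    have "D \<inter> (+) (a + b) ` D = {}"
      using unique_sums_sum_free[OF large d] D_sub by blast
    then show ?thesis
      by (simp add: card_Un_disjoint card_translate)
  qed
  also have "\<dots> \<le> card (- U)"
  proof -
    \<comment> \<open>A point \<open>c + z\<close> of \<open>U\<close> with \<open>c\<close> in
      \<open>{a, b}\<close> would represent the sum of an edge missing \<open>c\<close>.\<close>
    have D_U: "s \<notin> U" if "s \<in> D" for s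
    proof
      assume "s \<in> U"
      then obtain c z where c: "c \<in> {a, b}" and z: "z \<in> A" and s: "s = c + z"
        by (auto simp: U_def)
      obtain x y where xy: "unique_sum A x y" "{x, y} \<inter> {a, b} = {}" "s = x + y"
        using \<open>s \<in> D\<close> by (auto simp: D_def P_def)
      have "c \<in> A"
        using c unique_sumD(1,2)[OF ab] by blast
      with unique_sumD(4)[OF xy(1)] z s xy(3) have "c \<in> {x, y}"
        by blast
      with c xy(2) show False
        by blast
    qed
    \<comment> \<open>Translation by \<open>a + b\<close> swaps \<open>a + A\<close> and
      \<open>b + A\<close>.\<close>
    have U_inv: "s \<in> U" if su: "(a + b) + s \<in> U" for s
    proof -
      obtain c z where "c \<in> {a, b}" "z \<in> A" "(a + b) + s = c + z"
        using su by (auto simp: U_def)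
      then have "s = (a + b) + (c + z)"
        by (metis add_self_left)
      with \<open>c \<in> {a, b}\<close> have "s = b + z \<or> s = a + z"
        by (auto simp: ac_simps)
      with \<open>z \<in> A\<close> show ?thesis
        by (auto simp: U_def)
    qed
    have "D \<union> (+) (a + b) ` D \<subseteq> - U"
      using D_U U_inv by blast
    then show ?thesis
      by (simp add: card_mono)
  qed
  finally have "card P \<le> CARD('a) - card U"
    by (simp add: Compl_eq_Diff_UNIV card_Diff_subset)
  moreover have "card U \<le> CARD('a)"
    by (simp add: card_mono)
  moreover have "card U + 2 = 2 * card A"
  proof -
    have "(+) a ` A \<inter> (+) b ` A = (+) a ` (A \<inter> (+) (a + b) ` A)"
      by (subst image_Int) (simp_all add: image_image add.assoc)
    then have "card ((+) a ` A \<inter> (+) b ` A) = 2"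
      by (simp add: card_translate card_Int_translate[OF d])
    then show ?thesis
      using card_Un_Int[of "(+) a ` A" "(+) b ` A"] by (simp add: U_def card_translate)
  qed
  ultimately show ?thesis
    by (simp add: P_def)
qed

text \<open>Degrees sum to at most \<open>card P + 2 * (deg a + deg b)\<close>, and to at least the
  four degrees of \<open>Q\<close> plus one for each other vertex. As \<open>a b\<close> has the
  smaller degree sum, \<open>card A - 4 \<le> card P\<close>, against the bound on
  \<open>card P\<close>.\<close>

lemma unique_sum_edges_meet:
  assumes large: "3 * card A > CARD('a) + 6"
    and no_isolated: "\<And>x. x \<in> A \<Longrightarrow> \<exists>y. unique_sum A x y"
    and "unique_sum A a b" "unique_sum A c d"
  shows "{a, b} \<inter> {c, d} \<noteq> {}"
proof
  assume disj: "{a, b} \<inter> {c, d} = {}"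
  define deg where "deg x = card {y. unique_sum A x y}" for x
  have False
    if ab: "unique_sum A a b" and cd: "unique_sum A c d" and disj: "{a, b} \<inter> {c, d} = {}"
      and le: "deg a + deg b \<le> deg c + deg d" for a b c d
  proof -
    define N where "N x = {y. unique_sum A x y}" for x
    define P where "P = {(x, y). unique_sum A x y \<and> {x, y} \<inter> {a, b} = {}}"
    have card_N: "card (N x) = deg x" for x
      by (simp add: deg_def N_def)
    define Q where "Q = {a, b, c, d}"
    \<comment> \<open>An ordered edge outside \<open>P\<close> has \<open>a\<close> or
      \<open>b\<close> as its first or second entry.\<close>
    have "Sigma A N \<subseteq> P \<union> ({a} \<times> N a \<union> N a \<times> {a} \<union> ({b} \<times> N b \<union> N b \<times> {b}))"
      by (auto simp: P_def N_def dest: unique_sum_commute)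
    then have "card (Sigma A N) \<le> card (P \<union> ({a} \<times> N a \<union> N a \<times> {a} \<union> ({b} \<times> N b \<union> N b \<times> {b})))"
      by (intro card_mono) auto
    also have "\<dots> \<le> card P + (deg a + deg a + (deg b + deg b))"
      by (intro order_trans[OF card_Un_le add_mono]) (simp_all add: card_N)
    finally have "(\<Sum>x\<in>A. deg x) \<le> card P + 2 * deg a + 2 * deg b"
      by (simp add: card_N)
    moreover have "(\<Sum>x\<in>A. deg x) = (\<Sum>x\<in>A - Q. deg x) + (\<Sum>x\<in>Q. deg x)"
      using unique_sumD(1,2)[OF ab] unique_sumD(1,2)[OF cd]
      by (intro sum.subset_diff) (auto simp: Q_def)
    moreover have "(\<Sum>x\<in>Q. deg x) = deg a + deg b + deg c + deg d"
      using disj unique_sumD(3)[OF ab] unique_sumD(3)[OF cd] by (auto simp: Q_def)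
    moreover have "card (A - Q) \<le> (\<Sum>x\<in>A - Q. deg x)"
    proof -
      have "1 \<le> deg x" if "x \<in> A" for x
        using no_isolated[OF that] by (auto simp: deg_def Suc_le_eq card_gt_0_iff)
      then show ?thesis
        using sum_mono[of "A - Q" "\<lambda>_. 1" deg] by simp
    qed
    moreover have "card A \<le> card (A - Q) + 4"
    proof -
      have "card Q \<le> 4"
        by (simp add: Q_def card_insert_if)
      then show ?thesis
        using diff_card_le_card_Diff[of Q A] by simp
    qed
    ultimately have "card A \<le> card P + 4"
      using le by linarith
    then show False
      using card_pairs_missing_edge[OF large ab] large unfolding P_def by linarith
  qed
  from this[of a b c d] this[of c d a b] show False
    using assms disj by (metis Int_commute linear)
qed

text \<open>Deleting \<open>a\<close> loses some sum \<open>s\<close>, so every representation of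
  \<open>s\<close> involves \<open>a\<close> and is therefore \<open>a + b\<close> up to
  order.\<close>

lemma round_set_no_isolated:
  assumes "round_set A" "a \<in> A" "A \<noteq> {a}"
  shows "\<exists>b. unique_sum A a b"
proof -
  define B where "B = A - {a}"
  obtain c where c: "c \<in> B"
    using assms by (auto simp: B_def)
  have "B \<subset> A"
    using assms(2) by (auto simp: B_def)
  then have "B + B \<noteq> A + A"
    using assms(1) by (simp add: round_set_def)
  moreover have "B + B \<subseteq> A + A"
    using \<open>B \<subset> A\<close> by (simp add: set_plus_mono2 less_imp_le)
  ultimately obtain s where "s \<in> A + A" and s: "s \<notin> B + B"
    by blast
  have meets: "x = a \<or> y = a" if "x \<in> A" "y \<in> A" "x + y = s" for x y
    using that s by (auto simp: B_def set_plus_def)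
  obtain b where b: "b \<in> A" "s = a + b"
    using \<open>s \<in> A + A\<close> meets by (metis add.commute set_plus_elim)
  \<comment> \<open>The sum \<open>a + a = 0\<close> is not lost, being also \<open>c + c\<close>
    for the remaining point \<open>c\<close>.\<close>
  have "b \<noteq> a"
  proof
    assume "b = a"
    then have "s = c + c"
      by (simp add: b)
    then show False
      using c s set_plus_intro by blast
  qed
  moreover have "{x, y} = {a, b}" if "x \<in> A" "y \<in> A" "x + y = a + b" for x y
    using meets[of x y] that b by (auto simp: add.commute)
  ultimately show ?thesis
    using b(1) assms(2) by (auto simp: unique_sum_def)
qed

theorem large_round_set:
  assumes "round_set A" and large: "3 * card A > CARD('a) + 6"
  shows "\<exists>S g. sum_free S \<and> A = g +o (S \<union> {0})"
proof -
  have no_isolated: "\<exists>y. unique_sum A x y" if "x \<in> A" for x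
    using round_set_no_isolated[OF assms(1) that] large by fastforce
  have "\<exists>g\<in>A. \<forall>x\<in>A - {g}. unique_sum A g x"
  proof (rule ex_dominating_vertex)
    show "A \<noteq> {}"
      using large by auto
    show "{a, b} \<inter> {c, d} \<noteq> {}" if "unique_sum A a b" "unique_sum A c d" for a b c d
      using unique_sum_edges_meet[OF large no_isolated that] .
  qed (simp_all add: unique_sum_commute unique_sumD(1,3) no_isolated)
  then obtain g where g: "g \<in> A" "\<And>x. x \<in> A \<Longrightarrow> x \<noteq> g \<Longrightarrow> unique_sum A g x"
    by blast
  define S where "S = {s. s \<noteq> 0 \<and> g + s \<in> A}"
  \<comment> \<open>If \<open>s + t\<close> were in \<open>S\<close>, the edge from \<open>g\<close>
    to \<open>g + (s + t)\<close> would have its sum represented also by \<open>g + s\<close> and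
    \<open>g + t\<close>, both different from \<open>g\<close>.\<close>
  have "s + t \<notin> S" if "s \<in> S" "t \<in> S" for s t
  proof
    assume "s + t \<in> S"
    then have "unique_sum A g (g + (s + t))"
      by (intro g(2)) (auto simp: S_def)
    moreover have "(g + s) + (g + t) = g + (g + (s + t))"
      by (simp add: ac_simps)
    ultimately have "g + s = g \<or> g + t = g"
      using that unique_sumD(4)[of A g "g + (s + t)" "g + s" "g + t"] by (auto simp: S_def)
    then show False
      using that by (simp add: S_def)
  qed
  then have "sum_free S"
    by (auto simp: sum_free_def set_plus_def)
  moreover have "A = g +o (S \<union> {0})"
  proof
    show "A \<subseteq> g +o (S \<union> {0})"
    proof
      fix x
      assume "x \<in> A"
      then have "g + x \<in> S \<union> {0}"
        by (auto simp: S_def)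
      moreover have "x = g + (g + x)"
        by simp
      ultimately show "x \<in> g +o (S \<union> {0})"
        unfolding elt_set_plus_def by blast
    qed
    show "g +o (S \<union> {0}) \<subseteq> A"
      using g(1) by (auto simp: elt_set_plus_def S_def)
  qed
  ultimately show ?thesis
    by blast
qed

end

section \<open>Specialization to vectors over the two-element field\<close>

lemma UNIV_bit: "(UNIV :: bit set) = {0, 1}"
  by auto

instance bit :: finite
  by standard (simp add: UNIV_bit)

theorem theorem3p3:
  fixes A :: "(bit ^ 'n::finite) set"
  assumes "round_set A"
    and "real (card A) > 1 / 3 * 2 ^ CARD('n) + 2"
  shows "\<exists>(S :: (bit ^ 'n) set) (g :: bit ^ 'n). sum_free S \<and> A = g +o (S \<union> {0})"
proof -
  interpret exponent_two A
    by unfold_locales (simp add: vec_eq_iff)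
  have "CARD(bit) = 2"
    by (simp add: UNIV_bit)
  then have "CARD(bit ^ 'n) = 2 ^ CARD('n)"
    by simp
  moreover have "real (3 * card A) > real (2 ^ CARD('n) + 6)"
    using assms(2) by simp
  ultimately have "3 * card A > CARD(bit ^ 'n) + 6"
    by linarith
  with assms(1) show ?thesis
    by (rule large_round_set)
qed

end
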